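(* Let $R$ be an arbitrary commutative ring with $1$ in which $2$ is not invertible ($1/2\notin R$), and let $G$ be a large subgroup of the simply connected Chevalley group $G_{sc}(\mathbf C_2,R)$, where $\mathbf C_2=\{\pm e_1\pm e_2,\pm2e_1,\pm2e_2\}$. Then the subgroup $Y_{e_1+e_2}=\{x_{e_1+e_2}(t)\,x_{2e_2}(t)\mid t\in R\}$ is Diophantine in $G$.
   Context: Let $\mathcal L$ be the complex semisimple Lie algebra with root system $\Phi$, with Chevalley basis $\{h_i;x_\alpha\}$, and let $\pi$ be a faithful finite-dimensional representation of $\mathcal L$ with weight lattice $\Lambda_\pi$ (a lattice between the root lattice and the lattice of all weights $\Lambda_{sc}$). $G_\pi(\Phi,R)$ denotes the Chevalley group of type $(\Phi,\Lambda_\pi)$ over $R$, i.e. the group of $R$-points of the Chevalley--Demazure group scheme, realized as the subgroup of $\mathrm{SL}_n(R)$, $n=\dim\pi$, given by polynomial equations with integer coefficients in the matrix entries; $G_{sc}(\Phi,R)$ is the simply connected one, with $\Lambda_\pi=\Lambda_{sc}$. For $\alpha\in\Phi$, $t\in R$, $x_\alpha(t)=\exp(t\pi(x_\alpha))$ is the elementary root unipotent; $E_\pi(\Phi,R)$ is the subgroup generated by all $x_\alpha(t)$; a subgroup of $G_\pi(\Phi,R)$ is large if it contains $E_\pi(\Phi,R)$. A subset $H$ of a group $G$ is Diophantine in $G$ if it is definable in $G$ by a formula $\exists y_1\dots\exists y_n\bigwedge_{i=1}^k w_i(x,y_1,\dots,y_n)=1$, where each $w_i$ is a group word in $x,y_1,\dots,y_n$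 and constants from $G$. *)

theory Defs
  imports "HOL-Analysis.Analysis" "HOL-Algebra.Generated_Groups"
begin

section \<open>Diophantine subsets of a group\<close>

datatype (word_consts: 'g) group_word =
    Const 'g
  | Var nat
  | Inv "'g group_word"
  | Mult "'g group_word" "'g group_word"

primrec word_vars :: "'g group_word \<Rightarrow> nat set" where
  "word_vars (Const c) = {}"
| "word_vars (Var i) = {i}"
| "word_vars (Inv w) = word_vars w"
| "word_vars (Mult v w) = word_vars v \<union> word_vars w"

primrec word_eval :: "('g, 'm) monoid_scheme \<Rightarrow> (nat \<Rightarrow> 'g) \<Rightarrow> 'g group_word \<Rightarrow> 'g" where
  "word_eval G y (Const c) = c"
| "word_eval G y (Var i) = y i"
| "word_eval G y (Inv w) = inv\<^bsub>G\<^esub> (word_eval G y w)"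
| "word_eval G y (Mult v w) = word_eval G y v \<otimes>\<^bsub>G\<^esub> word_eval G y w"

text \<open>Variable \<open>0\<close> is the free variable \<open>x\<close>; variables \<open>1, \<dots>, n\<close> are the quantified ones.\<close>

definition diophantine_in :: "('g, 'm) monoid_scheme \<Rightarrow> 'g set \<Rightarrow> bool" where
  "diophantine_in G H \<longleftrightarrow>
     (\<exists>n (ws :: 'g group_word list).
        (\<forall>w \<in> set ws. word_consts w \<subseteq> carrier G \<and> word_vars w \<subseteq> {..n}) \<and>
        H = {x \<in> carrier G. \<exists>y. y 0 = x \<and> (\<forall>i \<in> {1..n}. y i \<in> carrier G) \<and>
                                 (\<forall>w \<in> set ws. word_eval G y w = \<one>\<^bsub>G\<^esub>)})"


section \<open>Chevalley groups attached to a family of integral root vectors\<close>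

text \<open>
  Throughout, \<open>X \<alpha>\<close> is the matrix of \<open>\<pi>(x\<^sub>\<alpha>)\<close> with respect to a basis of an
  admissible lattice of the representation space, so that every \<open>X \<alpha>\<close> and every divided
  power \<open>(X \<alpha>)\<^sup>k / k!\<close> has integer entries; in particular the division below is exact.
  The matrices \<open>X \<alpha>\<close> are nilpotent, so the exponential series may be cut off at the dimension.
\<close>

definition SL :: "('r::comm_ring_1 ^ 'n ^ 'n) monoid" where
  "SL = \<lparr>carrier = {A. det A = 1}, monoid.mult = (**), one = mat 1\<rparr>"

definition divided_power :: "int ^ 'n ^ 'n \<Rightarrow> nat \<Rightarrow> int ^ 'n ^ 'n" where
  "divided_power A k = map_matrix (\<lambda>a. a div fact k) ((((**) A) ^^ k) (mat 1))"

definition root_elt :: "('v \<Rightarrow> int ^ 'n ^ 'n) \<Rightarrow> 'v \<Rightarrow> 'r::comm_ring_1 \<Rightarrow> 'r ^ 'n ^ 'n" where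
  "root_elt X \<alpha> t =
     (\<Sum>k < CARD('n). mat (t ^ k) ** map_matrix of_int (divided_power (X \<alpha>) k))"

definition elementary_subgroup ::
    "'v set \<Rightarrow> ('v \<Rightarrow> int ^ 'n ^ 'n) \<Rightarrow> ('r::comm_ring_1 ^ 'n ^ 'n) set" where
  "elementary_subgroup \<Phi> X = generate SL {root_elt X \<alpha> t | \<alpha> t. \<alpha> \<in> \<Phi>}"

text \<open>Polynomials with integer coefficients in the matrix entries.\<close>

datatype 'n entry_poly =
    Coeff int
  | Entry 'n 'n
  | Add "'n entry_poly" "'n entry_poly"
  | Times "'n entry_poly" "'n entry_poly"

primrec poly_eval :: "'n entry_poly \<Rightarrow> 'r::comm_ring_1 ^ 'n ^ 'n \<Rightarrow> 'r" where
  "poly_eval (Coeff c) A = of_int c"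
| "poly_eval (Entry i j) A = A $ i $ j"
| "poly_eval (Add p q) A = poly_eval p A + poly_eval q A"
| "poly_eval (Times p q) A = poly_eval p A * poly_eval q A"

text \<open>
  The complex Chevalley group is generated by the root elements over \<open>\<complex>\<close>. The integral
  polynomials in the matrix entries that vanish on it are the equations over \<open>\<int>\<close> of the
  Chevalley--Demazure group scheme; its \<open>R\<close>-points are their common zeros in \<open>SL\<^sub>n(R)\<close>.
\<close>

definition chevalley_group ::
    "'v set \<Rightarrow> ('v \<Rightarrow> int ^ 'n ^ 'n) \<Rightarrow> ('r::comm_ring_1 ^ 'n ^ 'n) set" where
  "chevalley_group \<Phi> X =
     {A \<in> carrier SL. \<forall>p.
        (\<forall>B \<in> (elementary_subgroup \<Phi> X :: (complex ^ 'n ^ 'n) set). poly_eval p B = 0)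
          \<longrightarrow> poly_eval p A = 0}"

definition large_subgroup ::
    "'v set \<Rightarrow> ('v \<Rightarrow> int ^ 'n ^ 'n) \<Rightarrow> ('r::comm_ring_1 ^ 'n ^ 'n) set \<Rightarrow> bool" where
  "large_subgroup \<Phi> X G \<longleftrightarrow>
     subgroup G SL \<and> G \<subseteq> chevalley_group \<Phi> X \<and> elementary_subgroup \<Phi> X \<subseteq> G"


section \<open>Chevalley bases of type \<open>C\<^sub>2\<close> in the natural representation\<close>

definition e1 :: "real \<times> real" where "e1 = (1, 0)"
definition e2 :: "real \<times> real" where "e2 = (0, 1)"

definition C2 :: "(real \<times> real) set" where
  "C2 = {e1 + e2, e1 - e2, - e1 + e2, - e1 - e2,
         2 *\<^sub>R e1, - (2 *\<^sub>R e1), 2 *\<^sub>R e2, - (2 *\<^sub>R e2)}"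

definition coroot :: "real \<times> real \<Rightarrow> real \<times> real" where
  "coroot \<alpha> = (2 / (\<alpha> \<bullet> \<alpha>)) *\<^sub>R \<alpha>"

definition lie :: "'r::comm_ring_1 ^ 'n ^ 'n \<Rightarrow> 'r ^ 'n ^ 'n \<Rightarrow> 'r ^ 'n ^ 'n" where
  "lie A B = A ** B - B ** A"

definition symp_form :: "'r::comm_ring_1 ^ 4 ^ 4" where
  "symp_form = (\<chi> i j.
     if (i, j) \<in> {(1, 3), (2, 4)} then 1 else if (i, j) \<in> {(3, 1), (4, 2)} then - 1 else 0)"

definition sp4 :: "(complex ^ 4 ^ 4) set" where
  "sp4 = {A. transpose A ** symp_form + symp_form ** A = 0}"

text \<open>
  The diagonal Cartan subalgebra of \<open>sp4\<close>; \<open>e1\<close> and \<open>e2\<close> are its coordinate functionals,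
  so the basis vectors of the natural representation have weights \<open>e1, e2, -e1, -e2\<close>.
\<close>

definition cartan :: "complex \<Rightarrow> complex \<Rightarrow> complex ^ 4 ^ 4" where
  "cartan a b = (\<chi> i j. if i \<noteq> j then 0 else
     if i = 1 then a else if i = 2 then b else if i = 3 then - a else - b)"

definition functional :: "real \<times> real \<Rightarrow> complex \<Rightarrow> complex \<Rightarrow> complex" where
  "functional \<mu> a b = of_real (fst \<mu>) * a + of_real (snd \<mu>) * b"

definition root_space :: "real \<times> real \<Rightarrow> (complex ^ 4 ^ 4) set" where
  "root_space \<alpha> = {A \<in> sp4. \<forall>a b. lie (cartan a b) A = mat (functional \<alpha> a b) ** A}"

text \<open>
  The root vectors of a Chevalley basis of \<open>sp4\<close>, acting on the admissible lattice \<open>\<int>\<^sup>4\<close> of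
  the natural representation. The elements \<open>h\<^sub>i\<close> of the basis are determined by the root
  vectors, namely \<open>h\<^sub>i = [x\<^sub>\<alpha>, x\<^sub>-\<^sub>\<alpha>]\<close> for the simple roots \<open>\<alpha> = \<alpha>\<^sub>i\<close>. In the last clause
  \<open>p\<close> is the largest natural number such that \<open>\<beta> - p\<alpha>\<close> is a root.
\<close>

definition chevalley_root_vectors :: "(real \<times> real \<Rightarrow> int ^ 4 ^ 4) \<Rightarrow> bool" where
  "chevalley_root_vectors X \<longleftrightarrow>
     (\<forall>\<alpha> \<in> C2. map_matrix of_int (X \<alpha>) \<in> root_space \<alpha>) \<and>
     (\<forall>\<alpha> \<in> C2. map_matrix of_int (lie (X \<alpha>) (X (- \<alpha>))) =
        cartan (of_real (fst (coroot \<alpha>))) (of_real (snd (coroot \<alpha>)))) \<and>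
     (\<forall>\<alpha> \<in> C2. \<forall>\<beta> \<in> C2. \<alpha> + \<beta> \<in> C2 \<longrightarrow>
        (\<exists>p::nat. \<exists>s \<in> {1, -1}.
           (\<forall>k \<le> p. \<beta> - real k *\<^sub>R \<alpha> \<in> C2) \<and> \<beta> - real (p + 1) *\<^sub>R \<alpha> \<notin> C2 \<and>
           lie (X \<alpha>) (X \<beta>) = mat (s * int (p + 1)) ** X (\<alpha> + \<beta>)))"



section \<open>Consistency of the definitions\<close>

subsection \<open>The natural representation is simply connected\<close>

lemma C2_coords: "C2 = {(1,1),(1,-1),(-1,1),(-1,-1),(2,0),(-2,0),(0,2),(0,-2)}"
  by (simp add: C2_def e1_def e2_def)

definition weights :: "(real \<times> real) set" where
  "weights = {\<mu>. \<exists>v :: complex ^ 4. v \<noteq> 0 \<and> (\<forall>a b. cartan a b *v v = functional \<mu> a b *s v)}"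

lemma weights_eq: "weights = {e1, e2, - e1, - e2}"
proof (rule subset_antisym; rule subsetI)
  fix \<mu> assume "\<mu> \<in> weights"
  then obtain v :: "complex^4" where v: "v \<noteq> 0" and w: "\<And>a b. cartan a b *v v = functional \<mu> a b *s v"
    by (auto simp: weights_def)
  show "\<mu> \<in> {e1, e2, - e1, - e2}"
  proof -
    have "\<exists>i. v $ i \<noteq> 0" using v by (auto simp: vec_eq_iff)
    then obtain i where i: "v $ i \<noteq> 0" by blast
    have "(cartan a b *v v) $ i = cartan a b $ i $ i * v $ i" for a b
      using exhaust_4[of i] by (auto simp: matrix_vector_mult_def sum_4 cartan_def)
    then have d: "cartan a b $ i $ i = functional \<mu> a b" for a b
      using w[of a b] i by (metis mult_cancel_right vector_smult_component)
    show ?thesis using exhaust_4[of i] d[of 1 0] d[of 0 1]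
      by (cases \<mu>) (auto simp: e1_def e2_def cartan_def functional_def complex_eq_iff)
  qed
next
  fix \<mu> assume "\<mu> \<in> {e1, e2, - e1, - e2}"
  moreover have "axis 1 1 \<in> {v::complex^4. v \<noteq> 0 \<and> (\<forall>a b. cartan a b *v v = functional e1 a b *s v)}"
    "axis 2 1 \<in> {v::complex^4. v \<noteq> 0 \<and> (\<forall>a b. cartan a b *v v = functional e2 a b *s v)}"
    "axis 3 1 \<in> {v::complex^4. v \<noteq> 0 \<and> (\<forall>a b. cartan a b *v v = functional (-e1) a b *s v)}"
    "axis 4 1 \<in> {v::complex^4. v \<noteq> 0 \<and> (\<forall>a b. cartan a b *v v = functional (-e2) a b *s v)}"
    by (auto simp: axis_def e1_def e2_def vec_eq_iff forall_4 matrix_vector_mult_def sum_4 cartan_def functional_def)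
  ultimately show "\<mu> \<in> weights" unfolding weights_def by blast
qed

text \<open>
  The weights \<open>\<plusminus>e1, \<plusminus>e2\<close> generate the lattice of all integral weights of \<open>C\<^sub>2\<close>.
\<close>

lemma weight_lattice:
  "{\<mu>. \<forall>\<alpha> \<in> C2. \<mu> \<bullet> coroot \<alpha> \<in> \<int>} = {of_int m *\<^sub>R e1 + of_int n *\<^sub>R e2 | m n. True}"
  by (auto simp: C2_coords coroot_def inner_prod_def e1_def e2_def elim!: Ints_cases)


subsection \<open>Root vectors square to zero, so \<open>x\<^sub>\<alpha>(t) = 1 + t \<pi>(x\<^sub>\<alpha>)\<close>\<close>

definition diag_weight :: "4 \<Rightarrow> int" where
  "diag_weight i = (if i = 1 then 1 else if i = 2 then 2 else if i = 3 then -1 else -2)"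

lemma root_vector_square:
  assumes X: "chevalley_root_vectors X" and \<alpha>: "\<alpha> \<in> C2"
  shows "X \<alpha> ** X \<alpha> = 0"
proof -
  let ?A = "map_matrix of_int (X \<alpha>) :: complex ^ 4 ^ 4"
  have c: "cartan 1 2 = (\<chi> i j. if i = j then of_int (diag_weight i) else 0)"
    by (simp add: cartan_def diag_weight_def vec_eq_iff)
  have e: "lie (cartan 1 2) ?A = mat (functional \<alpha> 1 2) ** ?A"
    using X \<alpha> by (auto simp: chevalley_root_vectors_def root_space_def)
  have 1: "of_int ((diag_weight i - diag_weight j) * X \<alpha> $ i $ j) = functional \<alpha> 1 2 * of_int (X \<alpha> $ i $ j)" for i j
  proof -
    have "lie (cartan 1 2) ?A $ i $ j = (of_int (diag_weight i) - of_int (diag_weight j)) * of_int (X \<alpha> $ i $ j)"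
      unfolding c lie_def
      by (simp add: matrix_matrix_mult_def if_distrib[where f="\<lambda>x. x * _"] if_distrib[where f="\<lambda>x. _ * x"] algebra_simps cong: if_cong)
    moreover have "(mat (functional \<alpha> 1 2) ** ?A) $ i $ j = functional \<alpha> 1 2 * of_int (X \<alpha> $ i $ j)"
      by (simp add: matrix_matrix_mult_def mat_def if_distrib[where f="\<lambda>x. x * _"] cong: if_cong)
    ultimately show ?thesis using e by (auto simp del: mult_cancel_right)
  qed
  have 2: "functional \<alpha> 1 2 = of_int (diag_weight i - diag_weight j)" if "X \<alpha> $ i $ j \<noteq> 0" for i j
    using 1[of i j] that by simp
  have 3: "\<exists>r. functional \<alpha> 1 2 = complex_of_int r \<and> r \<in> {3,-1,1,-3,2,-2,4,-4}"
    using \<alpha> unfolding C2_def e1_def e2_def functional_def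
    by (elim insertE emptyE; simp) (metis of_int_1 of_int_minus of_int_numeral)+
  then obtain r where r: "functional \<alpha> 1 2 = complex_of_int r" "r \<in> {3,-1,1,-3,2,-2,4,-4}" by blast
  have "X \<alpha> $ i $ k * X \<alpha> $ k $ j = 0" for i k j
  proof (rule ccontr)
    assume "X \<alpha> $ i $ k * X \<alpha> $ k $ j \<noteq> 0"
    then have "r = diag_weight i - diag_weight k" "r = diag_weight k - diag_weight j"
      using 2[of i k] 2[of k j] r(1) by (auto simp flip: of_int_diff)
    then show False using r(2) exhaust_4[of i] exhaust_4[of j] exhaust_4[of k]
      unfolding diag_weight_def by (simp split: if_splits)
  qed
  then have "(\<Sum>k\<in>UNIV. X \<alpha> $ i $ k * X \<alpha> $ k $ j) = 0" for i j
    by (intro sum.neutral) blast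
  then show ?thesis by (simp add: vec_eq_iff matrix_matrix_mult_def)
qed

lemma root_elt_eq:
  assumes "chevalley_root_vectors X" and "\<alpha> \<in> C2"
  shows "root_elt X \<alpha> t = mat 1 + mat t ** map_matrix of_int (X \<alpha>)"
proof -
  have l: "{..<4::nat} = {0,1,2,3}" by auto
  have z: "A ** (0::int^4^4) = 0" for A :: "int^4^4" by (simp add: vec_eq_iff matrix_matrix_mult_def)
  have m: "map_matrix of_int (mat 1 :: int^4^4) = mat 1" "map_matrix (of_int :: int \<Rightarrow> 'a::comm_ring_1) (0::int^4^4) = 0"
    by (auto simp: vec_eq_iff mat_def)
  have d: "divided_power (X \<alpha>) 0 = mat 1" "divided_power (X \<alpha>) 1 = X \<alpha>"
     "divided_power (X \<alpha>) 2 = 0" "divided_power (X \<alpha>) 3 = 0"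
    using root_vector_square[OF assms]
    by (simp_all add: divided_power_def eval_nat_numeral matrix_mul_rid z del: fact_Suc)
       (simp_all add: vec_eq_iff)
  show ?thesis unfolding root_elt_def by (simp add: l d[simplified] m)
qed


subsection \<open>Existence of a Chevalley basis\<close>

definition std_entries :: "real \<times> real \<Rightarrow> (4 \<times> 4) set \<times> (4 \<times> 4) set" where
  "std_entries \<alpha> =
    (if \<alpha> = e1 + e2 then ({(1,4),(2,3)}, {})
     else if \<alpha> = - e1 - e2 then ({(4,1),(3,2)}, {})
     else if \<alpha> = e1 - e2 then ({(1,2)}, {(4,3)})
     else if \<alpha> = - e1 + e2 then ({(2,1)}, {(3,4)})
     else if \<alpha> = 2 *\<^sub>R e1 then ({(1,3)}, {})
     else if \<alpha> = - (2 *\<^sub>R e1) then ({(3,1)}, {})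
     else if \<alpha> = 2 *\<^sub>R e2 then ({(2,4)}, {})
     else ({(4,2)}, {}))"

definition std_root_vector :: "real \<times> real \<Rightarrow> int ^ 4 ^ 4" where
  "std_root_vector \<alpha> = (\<chi> i j. of_bool ((i,j) \<in> fst (std_entries \<alpha>)) - of_bool ((i,j) \<in> snd (std_entries \<alpha>)))"

lemma bex_imp: "(P \<longrightarrow> Q 0 1 \<or> Q 0 (-1) \<or> Q 1 1 \<or> Q 1 (-1)) \<Longrightarrow> P \<longrightarrow> (\<exists>p::nat. \<exists>s\<in>{1,-1::int}. Q p s)"
  by blast

lemmas mat_simps = vec_eq_iff forall_4 matrix_matrix_mult_def sum_4 mat_def
   std_root_vector_def std_entries_def e1_def e2_def lie_def

lemma std_root_space: "\<alpha> \<in> C2 \<Longrightarrow> map_matrix of_int (std_root_vector \<alpha>) \<in> root_space \<alpha>"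
  unfolding C2_coords
  apply (elim insertE emptyE; hypsubst)
         apply (auto simp: root_space_def sp4_def mat_simps transpose_def symp_form_def cartan_def functional_def)
  done

lemma std_coroot_relation: "\<alpha> \<in> C2 \<Longrightarrow> map_matrix of_int (lie (std_root_vector \<alpha>) (std_root_vector (- \<alpha>))) =
        cartan (of_real (fst (coroot \<alpha>))) (of_real (snd (coroot \<alpha>)))"
  unfolding C2_coords
  apply (elim insertE emptyE; hypsubst)
         apply (auto simp: mat_simps coroot_def cartan_def inner_prod_def)
  done

lemma all_le_1: "(\<forall>k\<le>Suc 0. P k) \<longleftrightarrow> P 0 \<and> P 1"
  by (auto simp: le_Suc_eq)

definition unit_mat :: "4 \<Rightarrow> 4 \<Rightarrow> int ^ 4 ^ 4" where
  "unit_mat i j = (\<chi> k l. if k = i \<and> l = j then 1 else 0)"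

lemma unit_mat_mult: "unit_mat i j ** unit_mat k l = (if j = k then unit_mat i l else 0)"
proof -
  have "unit_mat i j $ a $ m * unit_mat k l $ m $ b =
      (if m = j then (if a = i \<and> j = k \<and> b = l then 1 else 0) else 0)" for a b m
    by (auto simp: unit_mat_def)
  then show ?thesis
    by (simp add: vec_eq_iff matrix_matrix_mult_def unit_mat_def)
qed

lemma std_table:
  "std_root_vector (1, 1) = unit_mat 1 4 + unit_mat 2 3"
  "std_root_vector (-1, -1) = unit_mat 4 1 + unit_mat 3 2"
  "std_root_vector (1, -1) = unit_mat 1 2 - unit_mat 4 3"
  "std_root_vector (-1, 1) = unit_mat 2 1 - unit_mat 3 4"
  "std_root_vector (2, 0) = unit_mat 1 3"
  "std_root_vector (-2, 0) = unit_mat 3 1"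
  "std_root_vector (0, 2) = unit_mat 2 4"
  "std_root_vector (0, -2) = unit_mat 4 2"
  by (simp_all add: mat_simps unit_mat_def)

lemma mat_scale: "mat 1 ** A = A" "mat (-1) ** A = - A" "mat 2 ** A = A + A" "mat (-2) ** A = - A - A" for A :: "int^4^4"
  by (simp_all add: vec_eq_iff forall_4 matrix_matrix_mult_def sum_4 mat_def)

lemma matrix_mult_diff: "(A - B) ** C = A ** C - B ** C" "C ** (A - B) = C ** A - C ** B" for A :: "int^4^4"
  by (simp_all add: vec_eq_iff matrix_matrix_mult_def algebra_simps sum.distrib sum_subtractf)

lemma matrix_mult_add: "(A + B) ** C = A ** C + B ** C" "C ** (A + B) = C ** A + C ** B" for A :: "int^4^4"
  by (simp_all add: vec_eq_iff matrix_matrix_mult_def algebra_simps sum.distrib sum_subtractf)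

lemma std_commutator: "\<alpha> \<in> C2 \<Longrightarrow> \<beta> \<in> C2 \<Longrightarrow> \<alpha> + \<beta> \<in> C2 \<longrightarrow>
        (\<exists>p::nat. \<exists>s \<in> {1, -1}.
           (\<forall>k \<le> p. \<beta> - real k *\<^sub>R \<alpha> \<in> C2) \<and> \<beta> - real (p + 1) *\<^sub>R \<alpha> \<notin> C2 \<and>
           lie (std_root_vector \<alpha>) (std_root_vector \<beta>) = mat (s * int (p + 1)) ** std_root_vector (\<alpha> + \<beta>))"
  apply (rule bex_imp)
  unfolding C2_coords
  apply (elim insertE emptyE; hypsubst)
  apply (simp_all add: all_le_1 zero_prod_def)
  apply (simp_all add: std_table lie_def matrix_mult_diff matrix_mult_add unit_mat_mult mat_scale)
  done

lemma chevalley_root_vectors_std: "chevalley_root_vectors std_root_vector"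
  unfolding chevalley_root_vectors_def using std_root_space std_coroot_relation std_commutator by blast

end

theory Submission
  imports Defs
begin

text \<open>
  Up to signs \<open>X\<close> is the standard system of root vectors, so every \<open>A \<in> G\<close> is a symplectic
  matrix. If such an \<open>A\<close> commutes with \<open>x\<^sub>\<alpha>(1)\<close> for \<open>\<alpha> = 2e1, 2e2, e1 + e2, e1 - e2\<close>, then
  \<open>A = c x\<^bsub>2e1\<^esub>(p) x\<^bsub>e1+e2\<^esub>(q)\<close>, where \<open>c\<^sup>2 = 1\<close> and \<open>2q = 0\<close>. The commutator of
  \<open>x\<^bsub>e2-e1\<^esub>(\<plusminus>1)\<close> with \<open>A\<close> is insensitive to \<open>c\<close>, involves \<open>q\<close> only through \<open>2q\<close>, and equals
  \<open>x\<^bsub>e1+e2\<^esub>(\<plusminus>p) x\<^bsub>2e2\<^esub>(p)\<close>. Since \<open>x\<^bsub>2e1\<^esub>(p)\<close> lies in that centralizer for every \<open>p\<close>, the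
  set in question consists of the commutators of \<open>x\<^bsub>e2-e1\<^esub>(\<plusminus>1)\<close> with the elements of a
  centralizer of four constants.
\<close>

section \<open>Reduction to the standard root vectors\<close>

lemma monoid_SL: "monoid (SL :: ('r::comm_ring_1 ^ 'n ^ 'n) monoid)"
  by (rule monoidI) (auto simp: SL_def det_mul matrix_mul_assoc)

lemma mat_mult_entry: "(mat c ** A) $ i $ j = c * A $ i $ j"
  for A :: "'r::comm_ring_1 ^ 'n ^ 'n"
  by (simp add: matrix_matrix_mult_def mat_def if_distrib[where f="\<lambda>x. x * _"] cong: if_cong)

lemma lie_cartan_entry:
  "lie (cartan a b) A $ i $ j = (cartan a b $ i $ i - cartan a b $ j $ j) * A $ i $ j"
proof -
  have c: "cartan a b = (\<chi> i j. if i = j then cartan a b $ i $ i else 0)"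
    by (simp add: cartan_def vec_eq_iff)
  show ?thesis
    unfolding lie_def
    by (subst (1 2) c)
      (simp add: matrix_matrix_mult_def if_distrib[where f="\<lambda>x. x * _"]
        if_distrib[where f="\<lambda>x. _ * x"] algebra_simps cong: if_cong)
qed

text \<open>The element \<open>cartan 1 2\<close> has diagonal \<open>1, 2, -1, -2\<close>, and the
  eight roots take distinct values on it. Its eigenvalue equation alone therefore confines a root
  vector to the one or two positions whose weight difference is the root.\<close>

lemma root_vector_entry_eq_0:
  assumes X: "chevalley_root_vectors X" and \<alpha>: "\<alpha> \<in> C2"
    and ne: "of_int (diag_weight i - diag_weight j) \<noteq> functional \<alpha> 1 2"
  shows "X \<alpha> $ i $ j = 0"
proof -
  have d: "cartan 1 2 $ k $ k = of_int (diag_weight k)" for k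
    by (simp add: cartan_def diag_weight_def)
  have "lie (cartan 1 2) (map_matrix of_int (X \<alpha>)) $ i $ j
      = (mat (functional \<alpha> 1 2) ** map_matrix of_int (X \<alpha>)) $ i $ j"
    using X \<alpha> by (auto simp: chevalley_root_vectors_def root_space_def)
  with ne show ?thesis
    unfolding lie_cartan_entry mat_mult_entry d by simp
qed

text \<open>For a long root only one position survives the weight condition. For a short root two
  survive, and membership in \<open>sp4\<close> makes their entries equal or opposite, as in the
  standard vector.\<close>

lemma root_vector_proportional:
  assumes X: "chevalley_root_vectors X" and \<alpha>: "\<alpha> \<in> C2"
  shows "\<exists>c. X \<alpha> = mat c ** std_root_vector \<alpha>"
proof -
  have "map_matrix of_int (X \<alpha>) \<in> sp4"
    using X \<alpha> by (auto simp: chevalley_root_vectors_def root_space_def)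
  then have sp: "(transpose (map_matrix of_int (X \<alpha>)) ** symp_form
      + symp_form ** map_matrix of_int (X \<alpha>)) $ i $ j = (0::complex)" for i j
    by (simp add: sp4_def)
  have "of_int (X \<alpha> $ 1 $ 4) = (of_int (X \<alpha> $ 2 $ 3) :: complex)"
    "of_int (X \<alpha> $ 4 $ 1) = (of_int (X \<alpha> $ 3 $ 2) :: complex)"
    "of_int (X \<alpha> $ 4 $ 3) = (of_int (- X \<alpha> $ 1 $ 2) :: complex)"
    "of_int (X \<alpha> $ 3 $ 4) = (of_int (- X \<alpha> $ 2 $ 1) :: complex)"
    using sp[of 3 4] sp[of 1 2] sp[of 3 2] sp[of 4 1]
    by (simp_all add: matrix_matrix_mult_def sum_4 transpose_def symp_form_def eq_neg_iff_add_eq_0 add.commute)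
  then have sp': "X \<alpha> $ 1 $ 4 = X \<alpha> $ 2 $ 3" "X \<alpha> $ 4 $ 1 = X \<alpha> $ 3 $ 2"
    "X \<alpha> $ 4 $ 3 = - X \<alpha> $ 1 $ 2" "X \<alpha> $ 3 $ 4 = - X \<alpha> $ 2 $ 1"
    by (simp_all only: of_int_eq_iff)
  have "\<exists>i j. X \<alpha> = mat (X \<alpha> $ i $ j) ** std_root_vector \<alpha>"
  proof -
    note simps = vec_eq_iff mat_mult_entry forall_4 std_table unit_mat_def diag_weight_def functional_def
        root_vector_entry_eq_0[OF X] sp'
    consider "\<alpha> = (1,1)" | "\<alpha> = (1,-1)" | "\<alpha> = (-1,1)" | "\<alpha> = (-1,-1)"
      | "\<alpha> = (2,0)" | "\<alpha> = (-2,0)" | "\<alpha> = (0,2)" | "\<alpha> = (0,-2)"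
      using \<alpha> unfolding C2_coords by blast
    then show ?thesis
    proof cases
      case 1
      then show ?thesis using \<alpha> sp' by (intro exI[of _ 1] exI[of _ 4]) (simp add: simps)
    next
      case 2
      then show ?thesis using \<alpha> sp' by (intro exI[of _ 1] exI[of _ 2]) (simp add: simps)
    next
      case 3
      then show ?thesis using \<alpha> sp' by (intro exI[of _ 2] exI[of _ 1]) (simp add: simps)
    next
      case 4
      then show ?thesis using \<alpha> sp' by (intro exI[of _ 4] exI[of _ 1]) (simp add: simps)
    next
      case 5
      then show ?thesis using \<alpha> by (intro exI[of _ 1] exI[of _ 3]) (simp add: simps)
    next
      case 6
      then show ?thesis using \<alpha> by (intro exI[of _ 3] exI[of _ 1]) (simp add: simps)
    next
      case 7
      then show ?thesis using \<alpha> by (intro exI[of _ 2] exI[of _ 4]) (simp add: simps)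
    next
      case 8
      then show ?thesis using \<alpha> by (intro exI[of _ 4] exI[of _ 2]) (simp add: simps)
    qed
  qed
  then show ?thesis by blast
qed

text \<open>If \<open>c\<close> and \<open>d\<close> are the scalars for \<alpha> and -\<alpha>, the
  coroot relation says that \<open>c * d\<close> times a nonzero diagonal matrix is that matrix
  itself. Hence \<open>c * d = 1\<close> in the integers, where the only units are 1 and -1.\<close>

lemma root_vector_sign:
  assumes X: "chevalley_root_vectors X" and \<alpha>: "\<alpha> \<in> C2"
  shows "\<exists>c\<in>{1,-1}. X \<alpha> = mat c ** std_root_vector \<alpha>"
proof -
  have \<alpha>': "- \<alpha> \<in> C2" using \<alpha> by (auto simp: C2_coords)
  obtain c where c: "X \<alpha> = mat c ** std_root_vector \<alpha>"
    using root_vector_proportional[OF X \<alpha>] by blast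
  obtain d where d: "X (- \<alpha>) = mat d ** std_root_vector (- \<alpha>)"
    using root_vector_proportional[OF X \<alpha>'] by blast
  let ?h = "cartan (of_real (fst (coroot \<alpha>))) (of_real (snd (coroot \<alpha>)))"
  have "?h = map_matrix of_int (lie (X \<alpha>) (X (- \<alpha>)))"
    using X \<alpha> by (auto simp: chevalley_root_vectors_def)
  also have "lie (X \<alpha>) (X (- \<alpha>)) = mat (c * d) ** lie (std_root_vector \<alpha>) (std_root_vector (- \<alpha>))"
    unfolding c d lie_def
    by (simp add: vec_eq_iff mat_mult_entry)
      (simp add: matrix_matrix_mult_def[of "mat _ ** _"] mat_mult_entry, simp add: matrix_matrix_mult_def algebra_simps sum_distrib_left)
  also have "map_matrix of_int \<dots> = (mat (of_int (c * d)) :: complex^4^4) **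
      map_matrix of_int (lie (std_root_vector \<alpha>) (std_root_vector (- \<alpha>)))"
    by (simp add: vec_eq_iff mat_mult_entry)
  also have "map_matrix of_int (lie (std_root_vector \<alpha>) (std_root_vector (- \<alpha>))) = ?h"
    by (rule std_coroot_relation[OF \<alpha>])
  finally have h: "?h $ i $ i = of_int (c * d) * ?h $ i $ i" for i
    by (metis mat_mult_entry)
  have "?h $ 1 $ 1 \<noteq> 0 \<or> ?h $ 2 $ 2 \<noteq> 0"
    using \<alpha> by (auto simp: C2_coords cartan_def coroot_def zero_prod_def)
  then have "of_int (c * d) = (1::complex)"
    using h[of 1] h[of 2] by (metis mult_cancel_right2)
  then have "c * d = 1"
    by (simp only: of_int_eq_1_iff)
  then have "c \<in> {1, -1}"
    by (auto simp: zmult_eq_1_iff)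
  with c show ?thesis by blast
qed

lemma std_root_elt:
  "\<alpha> \<in> C2 \<Longrightarrow> root_elt std_root_vector \<alpha> t = mat 1 + mat t ** map_matrix of_int (std_root_vector \<alpha>)"
  by (rule root_elt_eq[OF chevalley_root_vectors_std])

text \<open>The sign passes from the root vector to the parameter. It is recorded as
  \<open>c * c = 1\<close>: multiplication by \<open>c\<close> is then an involution of the ring, so
  reparametrizing by \<open>c\<close> does not change a set of root elements.\<close>

lemma root_elt_sign:
  assumes X: "chevalley_root_vectors X" and \<alpha>: "\<alpha> \<in> C2"
  obtains c where "c * c = 1"
    "\<And>t :: 'r::comm_ring_1. root_elt X \<alpha> t = root_elt std_root_vector \<alpha> (c * t)"
proof -
  obtain c where c: "c \<in> {1, -1}" "X \<alpha> = mat c ** std_root_vector \<alpha>"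
    using root_vector_sign[OF X \<alpha>] by blast
  have "root_elt X \<alpha> t = root_elt std_root_vector \<alpha> (of_int c * t)" for t :: 'r
    unfolding root_elt_eq[OF X \<alpha>] std_root_elt[OF \<alpha>] c(2)
    by (simp add: vec_eq_iff mat_mult_entry)
  moreover have "of_int c \<in> {1, -1::'r}" using c by auto
  ultimately show thesis using that[of "of_int c"] by auto
qed

lemma elementary_subgroup_std:
  assumes X: "chevalley_root_vectors X"
  shows "(elementary_subgroup C2 X :: ('r::comm_ring_1 ^ 4 ^ 4) set) = elementary_subgroup C2 std_root_vector"
proof -
  have "range (root_elt X \<alpha>) = (range (root_elt std_root_vector \<alpha>) :: ('r ^ 4 ^ 4) set)" if \<alpha>: "\<alpha> \<in> C2" for \<alpha>
  proof -
    obtain c :: 'r where c: "c * c = 1" "\<And>t. root_elt X \<alpha> t = root_elt std_root_vector \<alpha> (c * t)"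
      using root_elt_sign[OF X \<alpha>] by metis
    have "c * (c * t) = t" for t by (simp add: c(1) flip: mult.assoc)
    then show ?thesis using c(2) by (auto simp: image_iff) metis
  qed
  then have "(\<Union>\<alpha>\<in>C2. range (root_elt X \<alpha>)) = (\<Union>\<alpha>\<in>C2. range (root_elt std_root_vector \<alpha>) :: ('r ^ 4 ^ 4) set)"
    by simp
  moreover have "{root_elt Z \<alpha> t :: 'r ^ 4 ^ 4 | \<alpha> t. \<alpha> \<in> C2} = (\<Union>\<alpha>\<in>C2. range (root_elt Z \<alpha>))" for Z
    by auto
  ultimately show ?thesis by (simp add: elementary_subgroup_def)
qed

text \<open>Elementary subgroups enter twice: over the ring itself as a lower bound for
  \<open>G\<close>, and over the complex numbers through the equations of the Chevalley group. Both
  are independent of the signs.\<close>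

lemma large_subgroup_std:
  assumes "chevalley_root_vectors X"
  shows "large_subgroup C2 X G \<longleftrightarrow> large_subgroup C2 std_root_vector G"
  unfolding large_subgroup_def chevalley_group_def elementary_subgroup_std[OF assms] ..

section \<open>Symplectic matrices, their inverses and determinants\<close>

lemma mult_symp_form_entry:
  fixes A :: "'r::comm_ring_1 ^ 4 ^ 'n"
  shows "(A ** symp_form) $ i $ 1 = - A $ i $ 3" "(A ** symp_form) $ i $ 2 = - A $ i $ 4"
    "(A ** symp_form) $ i $ 3 = A $ i $ 1" "(A ** symp_form) $ i $ 4 = A $ i $ 2"
  by (simp_all add: matrix_matrix_mult_def sum_4 symp_form_def)

lemma symp_form_entry:
  "symp_form $ 1 $ 1 = 0" "symp_form $ 1 $ 2 = 0" "symp_form $ 1 $ 3 = 1" "symp_form $ 1 $ 4 = 0"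
  "symp_form $ 2 $ 1 = 0" "symp_form $ 2 $ 2 = 0" "symp_form $ 2 $ 3 = 0" "symp_form $ 2 $ 4 = 1"
  "symp_form $ 3 $ 1 = -1" "symp_form $ 3 $ 2 = 0" "symp_form $ 3 $ 3 = 0" "symp_form $ 3 $ 4 = 0"
  "symp_form $ 4 $ 1 = 0" "symp_form $ 4 $ 2 = -1" "symp_form $ 4 $ 3 = 0" "symp_form $ 4 $ 4 = 0"
  by (simp_all add: symp_form_def)

lemma symp_form_square: "symp_form ** symp_form = mat (-1)"
  by (simp add: vec_eq_iff forall_4 mult_symp_form_entry symp_form_entry mat_def)

lemma matrix_mult_distrib:
  fixes A B :: "'r::comm_ring_1 ^ 'n ^ 'n"
  shows "(A + B) ** C = A ** C + B ** C" "C ** (A + B) = C ** A + C ** B"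
    "(A - B) ** C = A ** C - B ** C" "C ** (A - B) = C ** A - C ** B"
  by (simp_all add: vec_eq_iff matrix_matrix_mult_def algebra_simps sum.distrib sum_subtractf)

lemma mat_mult_assoc:
  fixes A B :: "'r::comm_ring_1 ^ 'n ^ 'n"
  shows "(mat c ** A) ** B = mat c ** (A ** B)" "A ** (mat c ** B) = mat c ** (A ** B)"
proof -
  have "A ** mat c = mat c ** A"
    by (simp add: vec_eq_iff mat_mult_entry)
      (simp add: matrix_matrix_mult_def mat_def if_distrib[where f="\<lambda>x. _ * x"] mult.commute cong: if_cong)
  then show "(mat c ** A) ** B = mat c ** (A ** B)" "A ** (mat c ** B) = mat c ** (A ** B)"
    by (simp_all add: matrix_mul_assoc)
qed

lemma mat_mat_mult: "mat c ** (mat d ** A) = mat (c * d) ** A" for A :: "'r::comm_ring_1 ^ 'n ^ 'n"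
  by (simp add: vec_eq_iff mat_mult_entry mult.assoc)

lemma map_matrix_of_int_mult:
  "map_matrix of_int (A ** B) = (map_matrix of_int A ** map_matrix of_int B :: 'r::comm_ring_1 ^ 'n ^ 'n)"
  by (simp add: vec_eq_iff matrix_matrix_mult_def)

lemma mat_neg_square: "mat (-1) ** mat (-1) = (mat 1 :: 'r::comm_ring_1 ^ 'n ^ 'n)"
  by (simp add: vec_eq_iff mat_mult_entry) (simp add: mat_def)

text \<open>The first equation makes \<open>symp_inverse A\<close> a left inverse of
  \<open>A\<close> and the second a right inverse, both by pure matrix algebra.\<close>

definition symplectic :: "'r::comm_ring_1 ^ 4 ^ 4 \<Rightarrow> bool" where
  "symplectic A \<longleftrightarrow>
     transpose A ** symp_form ** A = symp_form \<and> A ** symp_form ** transpose A = symp_form"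

text \<open>Since \<open>symp_form\<close> squares to -1, the equation
  \<open>transpose A ** symp_form ** A = symp_form\<close> leads to this formula for the
  inverse.\<close>

definition symp_inverse :: "'r::comm_ring_1 ^ 4 ^ 4 \<Rightarrow> 'r ^ 4 ^ 4" where
  "symp_inverse A = mat (-1) ** (symp_form ** transpose A ** symp_form)"

lemma symp_inverse:
  assumes "symplectic A"
  shows "symp_inverse A ** A = mat 1" "A ** symp_inverse A = mat 1"
proof -
  have "symp_inverse A ** A = mat (-1) ** (symp_form ** (transpose A ** symp_form ** A))"
    unfolding symp_inverse_def by (simp only: matrix_mul_assoc)
  then show "symp_inverse A ** A = mat 1"
    using assms by (simp add: symplectic_def symp_form_square mat_neg_square)
  have "A ** symp_inverse A = mat (-1) ** ((A ** symp_form ** transpose A) ** symp_form)"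
    unfolding symp_inverse_def mat_mult_assoc(2) by (simp only: matrix_mul_assoc)
  then show "A ** symp_inverse A = mat 1"
    using assms by (simp add: symplectic_def symp_form_square mat_neg_square)
qed

lemma symplectic_mult:
  assumes "symplectic A" "symplectic B"
  shows "symplectic (A ** B)"
proof -
  have "transpose (A ** B) ** symp_form ** (A ** B) = transpose B ** (transpose A ** symp_form ** A) ** B"
    "A ** B ** symp_form ** transpose (A ** B) = A ** (B ** symp_form ** transpose B) ** transpose A"
    by (simp_all add: matrix_transpose_mul matrix_mul_assoc)
  then show ?thesis using assms by (simp add: symplectic_def)
qed

lemma symplectic_symp_inverse:
  assumes "symplectic A"
  shows "symplectic (symp_inverse A)"
proof -
  let ?B = "symp_inverse A"
  have i: "A ** ?B = mat 1" "?B ** A = mat 1" using symp_inverse[OF assms] by auto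
  have "transpose ?B ** symp_form ** ?B = transpose ?B ** (transpose A ** symp_form ** A) ** ?B"
    using assms by (simp add: symplectic_def)
  also have "\<dots> = transpose (A ** ?B) ** symp_form ** (A ** ?B)"
    by (simp add: matrix_transpose_mul matrix_mul_assoc)
  finally have 1: "transpose ?B ** symp_form ** ?B = symp_form"
    by (simp add: i)
  have "?B ** symp_form ** transpose ?B = ?B ** (A ** symp_form ** transpose A) ** transpose ?B"
    using assms by (simp add: symplectic_def)
  also have "\<dots> = (?B ** A) ** symp_form ** transpose (?B ** A)"
    by (simp add: matrix_transpose_mul matrix_mul_assoc)
  finally show ?thesis using 1 by (simp add: i symplectic_def)
qed

text \<open>The negative of \<open>symp_form\<close> is its inverse, so the determinant is a unit;
  no expansion is carried out.\<close>

lemma det_symp_form: "det (symp_form :: 'r::comm_ring_1 ^ 4 ^ 4) dvd 1"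
proof -
  have "symp_form ** (mat (-1) ** symp_form) = (mat 1 :: 'r ^ 4 ^ 4)"
    by (simp add: mat_mult_assoc symp_form_square mat_neg_square)
  then have "det (symp_form :: 'r ^ 4 ^ 4) * det (mat (-1) ** symp_form :: 'r ^ 4 ^ 4) = 1"
    by (simp flip: det_mul)
  then show ?thesis by (metis dvd_triv_left)
qed

text \<open>Determinants are taken in a symplectic equation, and the unit
  \<open>det symp_form\<close> is cancelled.\<close>

lemma det_symplectic_square:
  fixes A :: "'r::comm_ring_1 ^ 4 ^ 4"
  assumes "symplectic A"
  shows "det A * det A = 1"
proof -
  obtain u where u: "1 = det (symp_form :: 'r ^ 4 ^ 4) * u"
    using det_symp_form by (metis dvdE)
  have d: "det A * det (symp_form :: 'r ^ 4 ^ 4) * det A = det (symp_form :: 'r ^ 4 ^ 4)"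
    using assms by (metis symplectic_def det_mul det_transpose)
  have "det A * det A = (det A * det A) * (det (symp_form :: 'r ^ 4 ^ 4) * u)"
    by (simp flip: u)
  also have "\<dots> = (det A * det (symp_form :: 'r ^ 4 ^ 4) * det A) * u"
    by (simp only: ac_simps)
  finally show ?thesis
    by (simp only: d u[symmetric])
qed

lemma symplectic_inv:
  assumes "symplectic A" "A \<in> carrier SL"
  shows "inv\<^bsub>SL\<^esub> A = symp_inverse A"
proof -
  have "det A * det (symp_inverse A) = 1"
    by (simp add: symp_inverse[OF assms(1)] flip: det_mul)
  then have "symp_inverse A \<in> carrier SL" using assms(2) by (simp add: SL_def)
  then show ?thesis
    using monoid.inv_unique'[OF monoid_SL assms(2), of "symp_inverse A"] symp_inverse[OF assms(1)]
    by (simp add: SL_def)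
qed

section \<open>Root elements are symplectic\<close>

lemma transpose_linear:
  "transpose (A + B) = transpose A + transpose B"
  "transpose (A - B) = transpose A - transpose B"
  "transpose (mat c ** A) = mat c ** transpose A"
  for A B :: "'r::comm_ring_1 ^ 'n ^ 'n"
  by (simp_all add: vec_eq_iff mat_mult_entry) (simp_all add: transpose_def mat_mult_entry)

text \<open>The relation defining \<open>sp4\<close> is proved over the integers, in a left and a
  right form, so that \<open>map_matrix of_int\<close> carries it to every commutative ring.\<close>

lemma std_root_vector_infinitesimal_symplectic:
  assumes "\<alpha> \<in> C2"
  shows "transpose (std_root_vector \<alpha>) ** symp_form = mat (-1) ** (symp_form ** std_root_vector \<alpha>)"
    and "symp_form ** transpose (std_root_vector \<alpha>) = mat (-1) ** (std_root_vector \<alpha> ** symp_form)"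
proof -
  have J: "symp_form = unit_mat 1 3 + unit_mat 2 4 - unit_mat 3 1 - unit_mat 4 2"
    by (simp add: vec_eq_iff forall_4 symp_form_entry unit_mat_def)
  have T: "transpose (unit_mat i j) = unit_mat j i" for i j
    by (auto simp: vec_eq_iff transpose_def unit_mat_def)
  show "transpose (std_root_vector \<alpha>) ** symp_form = mat (-1) ** (symp_form ** std_root_vector \<alpha>)"
    and "symp_form ** transpose (std_root_vector \<alpha>) = mat (-1) ** (std_root_vector \<alpha> ** symp_form)"
    using assms unfolding C2_coords
    by (auto simp: std_table J T transpose_linear matrix_mult_diff matrix_mult_add unit_mat_mult mat_scale)
qed

lemma std_root_elt_add:
  fixes s t :: "'r::comm_ring_1"
  assumes "\<alpha> \<in> C2"
  shows "root_elt std_root_vector \<alpha> s ** root_elt std_root_vector \<alpha> t = root_elt std_root_vector \<alpha> (s + t)"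
proof -
  let ?N = "map_matrix of_int (std_root_vector \<alpha>) :: 'r ^ 4 ^ 4"
  have "?N ** ?N = 0"
    using root_vector_square[OF chevalley_root_vectors_std assms]
      map_matrix_of_int_mult[of "std_root_vector \<alpha>" "std_root_vector \<alpha>", where 'r='r]
    by (simp add: vec_eq_iff)
  then show ?thesis
    unfolding std_root_elt[OF assms]
    by (simp add: matrix_mult_distrib mat_mult_assoc)
      (simp add: vec_eq_iff mat_mult_entry algebra_simps)
qed

text \<open>Write \<open>x\<close> for the root element and \<open>J\<close> for
  \<open>symp_form\<close>. The relations for the root vector turn
  \<open>transpose (x t) ** J\<close> into \<open>J ** x (- t)\<close>, and \<open>x (- t)\<close>
  is inverse to \<open>x t\<close>. The second equation is symmetric.\<close>

lemma symplectic_std_root_elt: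
  fixes t :: "'r::comm_ring_1"
  assumes "\<alpha> \<in> C2"
  shows "symplectic (root_elt std_root_vector \<alpha> t)"
proof -
  let ?M = "std_root_vector \<alpha>"
  let ?N = "map_matrix of_int ?M :: 'r ^ 4 ^ 4"
  let ?J = "symp_form :: int ^ 4 ^ 4"
  let ?x = "root_elt std_root_vector \<alpha> :: 'r \<Rightarrow> 'r ^ 4 ^ 4"
  have J: "map_matrix of_int ?J = (symp_form :: 'r ^ 4 ^ 4)"
    by (simp add: vec_eq_iff forall_4 symp_form_entry)
  have T: "map_matrix of_int (transpose ?M) = transpose ?N"
    by (simp add: vec_eq_iff transpose_def)
  have m: "map_matrix of_int (mat (-1)) = (mat (-1) :: 'r ^ 4 ^ 4)"
    by (simp add: vec_eq_iff mat_def)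
  have N: "transpose ?N ** symp_form = mat (-1) ** (symp_form ** ?N)"
    "symp_form ** transpose ?N = mat (-1) ** (?N ** symp_form)"
    using std_root_vector_infinitesimal_symplectic[OF assms, THEN arg_cong, of "map_matrix of_int :: _ \<Rightarrow> 'r ^ 4 ^ 4"]
    by (simp_all only: map_matrix_of_int_mult J T m)
  have x0: "?x 0 = mat 1"
    unfolding std_root_elt[OF assms] by (simp add: vec_eq_iff mat_mult_entry)
  have T: "transpose (?x t) = mat 1 + mat t ** transpose ?N"
    unfolding std_root_elt[OF assms] by (simp add: transpose_linear transpose_mat)
  have x: "?x (- t) = mat 1 + mat (- t) ** ?N"
    unfolding std_root_elt[OF assms] ..
  have 1: "transpose (?x t) ** symp_form = symp_form ** ?x (- t)"
    "symp_form ** transpose (?x t) = ?x (- t) ** symp_form"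
    unfolding T x
    by (simp_all only: matrix_mult_distrib mat_mult_assoc(1) mat_mult_assoc(2)[of symp_form] N
        mat_mat_mult matrix_mul_lid matrix_mul_rid mult_minus1_right)
  have "?x (- t) ** ?x t = mat 1" "?x t ** ?x (- t) = mat 1"
    using std_root_elt_add[OF assms, of "-t" t] std_root_elt_add[OF assms, of t "-t"] by (simp_all add: x0)
  then have "symp_form ** (?x (- t) ** ?x t) = symp_form" "(?x t ** ?x (- t)) ** symp_form = symp_form"
    by simp_all
  then have "(transpose (?x t) ** symp_form) ** ?x t = symp_form" "?x t ** (symp_form ** transpose (?x t)) = symp_form"
    unfolding 1 by (simp_all only: matrix_mul_assoc)
  then show ?thesis
    by (simp only: symplectic_def matrix_mul_assoc simp_thms)
qed

text \<open>The determinant of a symplectic matrix squares to \<open>1\<close>, and \<open>x\<^sub>\<alpha>(t) = x\<^sub>\<alpha>(t/2)\<^sup>2\<close>.\<close>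

lemma det_std_root_elt:
  fixes t :: complex
  assumes "\<alpha> \<in> C2"
  shows "det (root_elt std_root_vector \<alpha> t) = 1"
proof -
  have "root_elt std_root_vector \<alpha> t = root_elt std_root_vector \<alpha> (t / 2) ** root_elt std_root_vector \<alpha> (t / 2)"
    by (simp add: std_root_elt_add[OF assms])
  then show ?thesis
    using det_symplectic_square[OF symplectic_std_root_elt[OF assms, of "t / 2"]] by (simp add: det_mul)
qed

section \<open>The Chevalley group consists of symplectic matrices\<close>

lemma symplectic_complex_elementary:
  assumes "A \<in> (elementary_subgroup C2 std_root_vector :: (complex ^ 4 ^ 4) set)"
  shows "symplectic A"
  using assms unfolding elementary_subgroup_def
proof (induction rule: generate.induct)
  case one
  then show ?case by (simp add: SL_def symplectic_def transpose_mat)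
next
  case (incl h)
  then show ?case using symplectic_std_root_elt by auto
next
  case (inv h)
  then obtain \<alpha> t where "h = root_elt std_root_vector \<alpha> t" "\<alpha> \<in> C2" by auto
  \<comment> \<open>The closed form of \<open>inv\<close> in \<open>SL\<close> applies to elements
    of the carrier, so the determinant of \<open>h\<close> must be known to be 1.\<close>
  then have "symplectic h" "h \<in> carrier SL"
    by (auto simp: symplectic_std_root_elt SL_def det_std_root_elt)
  then show ?case
    by (simp only: symplectic_inv symplectic_symp_inverse)
next
  case (eng h1 h2)
  then show ?case by (simp add: SL_def symplectic_mult)
qed

text \<open>The \<open>(i, j)\<close> entry of
  \<open>transpose A ** symp_form ** A - symp_form\<close>.\<close>

definition symp_poly_l :: "4 \<Rightarrow> 4 \<Rightarrow> 4 entry_poly" where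
  "symp_poly_l i j =
     Add (Add (Times (Entry 1 i) (Entry 3 j)) (Times (Entry 2 i) (Entry 4 j)))
       (Add (Times (Coeff (-1)) (Add (Times (Entry 3 i) (Entry 1 j)) (Times (Entry 4 i) (Entry 2 j))))
          (Coeff (- (symp_form $ i $ j))))"

text \<open>The \<open>(i, j)\<close> entry of
  \<open>A ** symp_form ** transpose A - symp_form\<close>.\<close>

definition symp_poly_r :: "4 \<Rightarrow> 4 \<Rightarrow> 4 entry_poly" where
  "symp_poly_r i j =
     Add (Add (Times (Entry i 1) (Entry j 3)) (Times (Entry i 2) (Entry j 4)))
       (Add (Times (Coeff (-1)) (Add (Times (Entry i 3) (Entry j 1)) (Times (Entry i 4) (Entry j 2))))
          (Coeff (- (symp_form $ i $ j))))"

lemma symplectic_iff_poly: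
  "symplectic A \<longleftrightarrow> (\<forall>i j. poly_eval (symp_poly_l i j) A = 0 \<and> poly_eval (symp_poly_r i j) A = 0)"
proof -
  have c: "of_int (symp_form $ i $ j) = (symp_form $ i $ j :: 'a)" for i j
    using exhaust_4[of i] exhaust_4[of j] by (elim disjE; simp add: symp_form_entry)
  have l: "(transpose A ** symp_form ** A) $ i $ j - symp_form $ i $ j = poly_eval (symp_poly_l i j) A" for i j
    unfolding matrix_matrix_mult_def[of _ A]
    by (simp add: symp_poly_l_def c sum_4 mult_symp_form_entry) (simp add: transpose_def)
  have r: "(A ** symp_form ** transpose A) $ i $ j - symp_form $ i $ j = poly_eval (symp_poly_r i j) A" for i j
    unfolding matrix_matrix_mult_def[of _ "transpose A"]
    by (simp add: symp_poly_r_def c sum_4 mult_symp_form_entry) (simp add: transpose_def)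
  show ?thesis
    unfolding l[symmetric] r[symmetric] symplectic_def vec_eq_iff right_minus_eq by blast
qed

text \<open>Being symplectic is a system of integral polynomial equations. These hold on the complex
  elementary subgroup, hence by the definition of \<open>chevalley_group\<close> they hold at its
  points over every ring.\<close>

lemma symplectic_chevalley_group:
  assumes "A \<in> chevalley_group C2 std_root_vector"
  shows "symplectic A"
proof -
  have "poly_eval p A = 0"
    if "\<And>B :: complex ^ 4 ^ 4. symplectic B \<Longrightarrow> poly_eval p B = 0" for p
    using assms that symplectic_complex_elementary unfolding chevalley_group_def by blast
  then show ?thesis
    unfolding symplectic_iff_poly by blast
qed

text \<open>\<open>symp_inverse\<close> supplies the inverses; it agrees with the inverse of
  \<open>SL\<close>, under which \<open>G\<close> is closed.\<close>

lemma group_symplectic_subgroup: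
  assumes G: "subgroup G SL" and symp: "\<And>A. A \<in> G \<Longrightarrow> symplectic A"
  shows "group (SL\<lparr>carrier := G\<rparr>)"
proof (rule groupI)
  fix A assume "A \<in> carrier (SL\<lparr>carrier := G\<rparr>)"
  then have A: "A \<in> G" by simp
  then have "inv\<^bsub>SL\<^esub> A = symp_inverse A"
    using subgroup.subset[OF G] symp by (auto intro: symplectic_inv)
  then have "symp_inverse A \<in> G"
    using subgroup.m_inv_closed[OF G A] by simp
  then show "\<exists>B\<in>carrier (SL\<lparr>carrier := G\<rparr>).
      B \<otimes>\<^bsub>SL\<lparr>carrier := G\<rparr>\<^esub> A = \<one>\<^bsub>SL\<lparr>carrier := G\<rparr>\<^esub>"
    using symp_inverse[OF symp[OF A]] by (auto simp: SL_def)
qed (use subgroup.m_closed[OF G] subgroup.one_closed[OF G] in \<open>auto simp: SL_def matrix_mul_assoc\<close>)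

section \<open>The centralizer of four root elements and its commutators\<close>

lemma unit_mat_mult_entry:
  fixes A :: "'r::comm_ring_1 ^ 4 ^ 4"
  shows "(map_matrix of_int (unit_mat i j) ** A) $ k $ l = (if k = i then A $ j $ l else 0)"
    and "(A ** map_matrix of_int (unit_mat i j)) $ k $ l = (if l = j then A $ k $ i else 0)"
proof -
  have "of_int (unit_mat i j $ k $ m) * A $ m $ l = (if m = j then (if k = i then A $ j $ l else 0) else 0)"
    "A $ k $ m * of_int (unit_mat i j $ m $ l) = (if m = i then (if l = j then A $ k $ i else 0) else 0)" for m
    by (auto simp: unit_mat_def)
  then show "(map_matrix of_int (unit_mat i j) ** A) $ k $ l = (if k = i then A $ j $ l else 0)"
    "(A ** map_matrix of_int (unit_mat i j)) $ k $ l = (if l = j then A $ k $ i else 0)"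
    by (simp_all add: matrix_matrix_mult_def)
qed

lemma map_matrix_of_int_linear:
  "map_matrix of_int (A + B) = (map_matrix of_int A + map_matrix of_int B :: 'r::comm_ring_1 ^ 'n ^ 'n)"
  "map_matrix of_int (A - B) = (map_matrix of_int A - map_matrix of_int B :: 'r::comm_ring_1 ^ 'n ^ 'n)"
  by (simp_all add: vec_eq_iff)

lemma std_root_elt_mult_entry:
  fixes A :: "'r::comm_ring_1 ^ 4 ^ 4"
  assumes "\<alpha> \<in> C2"
  shows "(root_elt std_root_vector \<alpha> t ** A) $ i $ j
      = A $ i $ j + t * (map_matrix of_int (std_root_vector \<alpha>) ** A) $ i $ j"
    and "(A ** root_elt std_root_vector \<alpha> t) $ i $ j
      = A $ i $ j + t * (A ** map_matrix of_int (std_root_vector \<alpha>)) $ i $ j"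
  by (simp_all add: std_root_elt[OF assms] matrix_mult_distrib mat_mult_assoc mat_mult_entry)

lemmas std_root_elt_mult_simps =
  std_root_elt_mult_entry std_table map_matrix_of_int_linear matrix_mult_distrib unit_mat_mult_entry

text \<open>Commuting with a root element at 1 means commuting with its root vector. The roots
  \<open>(2,0)\<close>, \<open>(0,2)\<close> and \<open>(1,1)\<close> make the diagonal constant and
  clear most other entries. The root \<open>(1,-1)\<close> gives opposite values at the positions
  \<open>(1,4)\<close> and \<open>(2,3)\<close>, while the symplectic form gives equal ones; hence
  \<open>q + q = 0\<close>.\<close>

lemma centralizer_positive_root_elts:
  fixes A :: "'r::comm_ring_1 ^ 4 ^ 4"
  assumes A: "symplectic A"
    and comm: "\<And>\<alpha>. \<alpha> \<in> {(2,0), (0,2), (1,1), (1,-1)} \<Longrightarrow>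
      A ** root_elt std_root_vector \<alpha> 1 = root_elt std_root_vector \<alpha> 1 ** A"
  obtains c p q where "c * c = 1" "q + q = 0"
    "A = (\<chi> i j. if i = j then c else if (i, j) = (1, 3) then c * p
            else if (i, j) \<in> {(1, 4), (2, 3)} then q else 0)"
proof -
  have N: "(A ** map_matrix of_int (std_root_vector \<alpha>)) $ i $ j
      = (map_matrix of_int (std_root_vector \<alpha>) ** A) $ i $ j"
    if "\<alpha> \<in> {(2,0), (0,2), (1,1), (1,-1)}" for \<alpha> i j
  proof -
    have "\<alpha> \<in> C2" using that by (auto simp: C2_coords)
    moreover have "(A ** root_elt std_root_vector \<alpha> 1) $ i $ j = (root_elt std_root_vector \<alpha> 1 ** A) $ i $ j"
      by (simp only: comm[OF that])
    ultimately show ?thesis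
      by (simp only: std_root_elt_mult_entry add_left_cancel mult_1)
  qed
  note simps = std_table map_matrix_of_int_linear matrix_mult_distrib unit_mat_mult_entry
  have a: "A $ 1 $ 1 = A $ 3 $ 3" "A $ 2 $ 1 = 0" "A $ 3 $ 1 = 0" "A $ 4 $ 1 = 0" "A $ 3 $ 2 = 0" "A $ 3 $ 4 = 0"
    using N[of "(2,0)" 1 3] N[of "(2,0)" 2 3] N[of "(2,0)" 3 3] N[of "(2,0)" 4 3]
      N[of "(2,0)" 1 2] N[of "(2,0)" 1 4]
    by (simp_all add: simps)
  have b: "A $ 1 $ 2 = 0" "A $ 2 $ 2 = A $ 4 $ 4" "A $ 4 $ 2 = 0" "A $ 4 $ 3 = 0"
    using N[of "(0,2)" 1 4] N[of "(0,2)" 2 4] N[of "(0,2)" 4 4] N[of "(0,2)" 2 3]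
    by (simp_all add: simps)
  have c: "A $ 4 $ 4 = A $ 1 $ 1"
    using N[of "(1,1)" 1 4] by (simp add: simps)
  have d: "A $ 2 $ 4 = 0" "A $ 2 $ 3 = - A $ 1 $ 4"
    using N[of "(1,-1)" 1 4] N[of "(1,-1)" 1 3] by (simp_all add: simps)
  have e: "A $ 1 $ 1 * A $ 1 $ 1 = 1"
    using A[unfolded symplectic_iff_poly, rule_format, of 1 3] a b c
    by (simp add: symp_poly_l_def symp_form_entry)
  have "A $ 1 $ 1 * A $ 2 $ 3 = A $ 1 $ 1 * A $ 1 $ 4"
    using A[unfolded symplectic_iff_poly, rule_format, of 3 4] a b c
    by (simp add: symp_poly_l_def symp_form_entry algebra_simps)
  then have "(A $ 1 $ 1 * A $ 1 $ 1) * A $ 2 $ 3 = (A $ 1 $ 1 * A $ 1 $ 1) * A $ 1 $ 4"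
    by (simp only: mult.assoc)
  then have f: "A $ 2 $ 3 = A $ 1 $ 4"
    by (simp only: e mult_1)
  show thesis
  \<comment> \<open>The instantiation is in the order of occurrence \<open>c\<close>,
    \<open>q\<close>, \<open>p\<close>. As \<open>c\<close> is its own inverse, \<open>p\<close> is
    \<open>c\<close> times the entry at \<open>(1,3)\<close>.\<close>
  proof (rule that[of "A $ 1 $ 1" "A $ 1 $ 4" "A $ 1 $ 1 * A $ 1 $ 3"])
    show "A $ 1 $ 4 + A $ 1 $ 4 = 0" using d f by simp
    have "A $ 1 $ 1 * (A $ 1 $ 1 * A $ 1 $ 3) = A $ 1 $ 3"
      by (simp add: e flip: mult.assoc)
    then show "A = (\<chi> i j. if i = j then A $ 1 $ 1 else if (i, j) = (1, 3) then A $ 1 $ 1 * (A $ 1 $ 1 * A $ 1 $ 3)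
            else if (i, j) \<in> {(1, 4), (2, 3)} then A $ 1 $ 4 else 0)"
      by (simp add: vec_eq_iff forall_4 a b c d(1) f)
  qed (fact e)
qed

text \<open>This is the commutator \<open>m A m^-1 A^-1\<close> with its inverses cleared, where
  \<open>m\<close> is the root element for \<open>(-1,1)\<close>, so that entries can be compared
  directly. The decisive entry is \<open>(2,4)\<close>: there \<open>e * e = 1\<close> cancels the
  terms in \<open>p\<close>, and \<open>q + q = 0\<close> identifies \<open>- e * q\<close> with
  \<open>e * q\<close>.\<close>

lemma commutator_identity:
  fixes e p q c :: "'r::comm_ring_1"
  assumes "e * e = 1" "q + q = 0"
    and A: "A = (\<chi> i j. if i = j then c else if (i, j) = (1, 3) then c * p
            else if (i, j) \<in> {(1, 4), (2, 3)} then q else 0)"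
  shows "root_elt std_root_vector (1,1) (e * p) ** root_elt std_root_vector (0,2) p
           ** (A ** root_elt std_root_vector (-1,1) e)
       = root_elt std_root_vector (-1,1) e ** A"
proof -
  have "2 * (e * q) = e * (q + q)" by (simp add: algebra_simps)
  then have q: "2 * (e * q) = 0" by (simp add: assms(2))
  have "e * p * (e * c) = e * e * (p * c)" by (simp only: ac_simps)
  then have p: "e * p * (e * c) = p * c" by (simp only: assms(1) mult_1)
  have C: "(1,1) \<in> C2" "(0,2) \<in> C2" "(-1,1) \<in> C2" by (auto simp: C2_coords)
  have "A $ 1 $ 1 = c" "A $ 1 $ 2 = 0" "A $ 1 $ 3 = c * p" "A $ 1 $ 4 = q"
    "A $ 2 $ 1 = 0" "A $ 2 $ 2 = c" "A $ 2 $ 3 = q" "A $ 2 $ 4 = 0"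
    "A $ 3 $ 1 = 0" "A $ 3 $ 2 = 0" "A $ 3 $ 3 = c" "A $ 3 $ 4 = 0"
    "A $ 4 $ 1 = 0" "A $ 4 $ 2 = 0" "A $ 4 $ 3 = 0" "A $ 4 $ 4 = c"
    by (simp_all add: A)
  then show ?thesis
    by (simp add: vec_eq_iff forall_4 std_root_elt_mult_simps C p q flip: matrix_mul_assoc)
qed

section \<open>The Diophantine description of the subgroup\<close>

definition commutation_word :: "'g \<Rightarrow> 'g group_word" where
  "commutation_word c = Mult (Mult (Var 1) (Const c)) (Inv (Mult (Const c) (Var 1)))"

lemma (in group) mult_inv_eq_one_iff:
  "a \<in> carrier G \<Longrightarrow> b \<in> carrier G \<Longrightarrow> a \<otimes> inv b = \<one> \<longleftrightarrow> a = b"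
  by (metis inv_closed inv_equality inv_inv r_inv)

lemma std_root_elt_mem_large:
  assumes "large_subgroup C2 std_root_vector G" "\<alpha> \<in> C2"
  shows "root_elt std_root_vector \<alpha> t \<in> G"
  using assms unfolding large_subgroup_def elementary_subgroup_def
  by (blast intro: generate.incl)

text \<open>The parameter \<open>e\<close> is the relative sign of the two root vectors, which
  remains after the reduction to the standard system.\<close>

lemma diophantine_std:
  fixes G :: "('r::comm_ring_1 ^ 4 ^ 4) set" and e :: 'r
  assumes large: "large_subgroup C2 std_root_vector G" and e: "e * e = 1"
  shows "diophantine_in (SL\<lparr>carrier := G\<rparr>)
           {root_elt std_root_vector (1,1) (e * t) ** root_elt std_root_vector (0,2) t | t. True}"
proof -
  let ?x = "root_elt std_root_vector :: _ \<Rightarrow> 'r \<Rightarrow> 'r ^ 4 ^ 4"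
  let ?G = "SL\<lparr>carrier := G\<rparr>"
  let ?Y = "{?x (1,1) (e * t) ** ?x (0,2) t | t. True}"
  have symp: "symplectic A" if "A \<in> G" for A
    using large that symplectic_chevalley_group unfolding large_subgroup_def by blast
  have "subgroup G SL"
    using large unfolding large_subgroup_def by blast
  then interpret group ?G
    using symp by (rule group_symplectic_subgroup)
  have mult: "A \<otimes>\<^bsub>?G\<^esub> B = A ** B" for A B by (simp add: SL_def)
  have closed: "A ** B \<in> G" if "A \<in> G" "B \<in> G" for A B
    using m_closed[of A B] that unfolding mult by simp
  have x: "?x \<alpha> t \<in> G" if "\<alpha> \<in> C2" for \<alpha> t
    using large that by (rule std_root_elt_mem_large)
  \<comment> \<open>Taking the argument \<open>e\<close> here gives the first factor of the
    commutator its sign, by \<open>commutator_identity\<close>.\<close>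
  let ?m = "?x (-1,1) e"
  let ?P = "[(2,0), (0,2), (1,1), (1,-1)] :: (real \<times> real) list"
  have C: "(1,1) \<in> C2" "(0,2) \<in> C2" "(-1,1) \<in> C2" "(2,0) \<in> C2" "(1,-1) \<in> C2" by (auto simp: C2_coords)
  have P: "set ?P \<subseteq> C2" using C by simp
  \<comment> \<open>With \<open>z\<close> for variable 1, the only quantified one, this word
    expresses \<open>x = m z m^-1 z^-1\<close>.\<close>
  define u where "u = Mult (Mult (Var 0) (Mult (Var 1) (Const ?m))) (Inv (Mult (Const ?m) (Var 1)))"
  define ws where "ws = u # map (\<lambda>\<alpha>. commutation_word (?x \<alpha> 1)) ?P"
  have eval: "(\<forall>w\<in>set ws. word_eval ?G y w = \<one>\<^bsub>?G\<^esub>) \<longleftrightarrow>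
      y 0 ** (y 1 ** ?m) = ?m ** y 1 \<and> (\<forall>\<alpha>\<in>set ?P. y 1 ** ?x \<alpha> 1 = ?x \<alpha> 1 ** y 1)"
    if y: "y 0 \<in> G" "y (Suc 0) \<in> G" for y
  proof -
    have c: "word_eval ?G y (commutation_word a) = \<one>\<^bsub>?G\<^esub> \<longleftrightarrow> y 1 ** a = a ** y 1" if "a \<in> G" for a
      unfolding commutation_word_def word_eval.simps mult
      by (subst mult_inv_eq_one_iff[unfolded mult]) (auto intro: closed that y)
    have "word_eval ?G y u = \<one>\<^bsub>?G\<^esub> \<longleftrightarrow> y 0 ** (y 1 ** ?m) = ?m ** y 1"
      unfolding u_def word_eval.simps mult
      by (subst mult_inv_eq_one_iff[unfolded mult]) (auto intro: closed y x C)
    then show ?thesis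
      using c[OF x[OF subsetD[OF P]]] by (simp add: ws_def)
  qed
  have mem: "g \<in> ?Y \<longleftrightarrow> g \<in> G \<and> (\<exists>y. y 0 = g \<and> (\<forall>i\<in>{1..1}. y i \<in> carrier ?G) \<and>
      (\<forall>w\<in>set ws. word_eval ?G y w = \<one>\<^bsub>?G\<^esub>))" for g
  proof
    assume "g \<in> ?Y"
    then obtain t where g: "g = ?x (1,1) (e * t) ** ?x (0,2) t" by blast
    \<comment> \<open>The long root \<open>2e1\<close> gives an element of the centralizer with any
      prescribed \<open>p\<close>.\<close>
    let ?z = "?x (2,0) t"
    let ?y = "\<lambda>i::nat. if i = 0 then g else ?z"
    have gG: "g \<in> G" unfolding g by (intro closed x C)
    \<comment> \<open>Written in the shape that \<open>commutator_identity\<close> expects, with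
      \<open>c = 1\<close>, \<open>p = t\<close> and \<open>q = 0\<close>.\<close>
    have z: "?z = (\<chi> i j. if i = j then 1 else if (i, j) = (1, 3) then 1 * t
            else if (i, j) \<in> {(1, 4), (2, 3)} then 0 else 0)"
      unfolding std_root_elt[OF C(4)]
      by (simp add: vec_eq_iff mat_mult_entry std_table unit_mat_def) (auto simp: mat_def)
    have "?z ** ?x \<alpha> 1 = ?x \<alpha> 1 ** ?z" if "\<alpha> \<in> set ?P" for \<alpha>
      unfolding z using that C
      by (auto simp: vec_eq_iff forall_4 std_root_elt_mult_simps)
    moreover have "g ** (?z ** ?m) = ?m ** ?z"
      unfolding g using commutator_identity[OF e _ z] by simp
    ultimately have "\<forall>w\<in>set ws. word_eval ?G ?y w = \<one>\<^bsub>?G\<^esub>"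
      by (subst eval) (auto simp: gG x C)
    then show "g \<in> G \<and> (\<exists>y. y 0 = g \<and> (\<forall>i\<in>{1..1}. y i \<in> carrier ?G) \<and>
        (\<forall>w\<in>set ws. word_eval ?G y w = \<one>\<^bsub>?G\<^esub>))"
      using gG x[OF C(4)] by (intro conjI exI[of _ ?y]) auto
  next
    assume "g \<in> G \<and> (\<exists>y. y 0 = g \<and> (\<forall>i\<in>{1..1}. y i \<in> carrier ?G) \<and>
        (\<forall>w\<in>set ws. word_eval ?G y w = \<one>\<^bsub>?G\<^esub>))"
    then obtain y where y: "g \<in> G" "y 0 = g" "y 1 \<in> G" "\<forall>w\<in>set ws. word_eval ?G y w = \<one>\<^bsub>?G\<^esub>"
      by auto
    then have w: "g ** (y 1 ** ?m) = ?m ** y 1" "\<And>\<alpha>. \<alpha> \<in> set ?P \<Longrightarrow> y 1 ** ?x \<alpha> 1 = ?x \<alpha> 1 ** y 1"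
      using eval[of y] by auto
    have comm: "y 1 ** ?x \<alpha> 1 = ?x \<alpha> 1 ** y 1" if "\<alpha> \<in> {(2,0), (0,2), (1,1), (1,-1)}" for \<alpha>
      using w(2)[of \<alpha>] that by simp
    obtain c p q where "q + q = 0"
      "y 1 = (\<chi> i j. if i = j then c else if (i, j) = (1, 3) then c * p
            else if (i, j) \<in> {(1, 4), (2, 3)} then q else 0)"
      by (rule centralizer_positive_root_elts[OF symp[OF y(3)] comm])
    from commutator_identity[OF e this]
    have "?x (1,1) (e * p) ** ?x (0,2) p ** (y 1 ** ?m) = g ** (y 1 ** ?m)"
      by (simp only: w(1))
    \<comment> \<open>Cancelling \<open>y 1 ** ?m\<close> in the group shows that \<open>p\<close>
      is the parameter of \<open>g\<close>.\<close>
    then have "?x (1,1) (e * p) ** ?x (0,2) p = g"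
      using right_cancel[of "y 1 ** ?m" "?x (1,1) (e * p) ** ?x (0,2) p" g] y(1,3)
      unfolding mult by (simp add: closed x C)
    then show "g \<in> ?Y" by blast
  qed
  have "word_consts w \<subseteq> carrier ?G \<and> word_vars w \<subseteq> {..1}" if "w \<in> set ws" for w
    using that x C by (auto simp: ws_def u_def commutation_word_def)
  then show ?thesis
    unfolding diophantine_in_def using mem by (intro exI[of _ 1] exI[of _ ws] conjI ballI) auto
qed

theorem proposition5:
  fixes X :: "real \<times> real \<Rightarrow> int ^ 4 ^ 4"
    and G :: "('r::comm_ring_1 ^ 4 ^ 4) set"
  assumes "chevalley_root_vectors X"
    and "\<not> (2 :: 'r) dvd 1"
    and "large_subgroup C2 X G"
  shows "diophantine_in (SL\<lparr>carrier := G\<rparr>)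
           {root_elt X (e1 + e2) t ** root_elt X (2 *\<^sub>R e2) t | t. True}"
proof -
  have C: "(1,1) \<in> C2" "(0,2) \<in> C2" by (auto simp: C2_coords)
  obtain a :: 'r where a: "a * a = 1" "\<And>t. root_elt X (1,1) t = root_elt std_root_vector (1,1) (a * t)"
    using root_elt_sign[OF assms(1) C(1)] by metis
  obtain b :: 'r where b: "b * b = 1" "\<And>t. root_elt X (0,2) t = root_elt std_root_vector (0,2) (b * t)"
    using root_elt_sign[OF assms(1) C(2)] by metis
  \<comment> \<open>Replacing \<open>t\<close> by \<open>b * t\<close> removes the sign
    \<open>b\<close> from the second factor and puts \<open>a * b\<close> on the first, so the
    standard case applies with \<open>e = a * b\<close>.\<close>
  let ?f = "\<lambda>t. root_elt std_root_vector (1,1) (a * b * t) ** root_elt std_root_vector (0,2) t"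
  have "b * (b * t) = t" for t by (simp add: b(1) flip: mult.assoc)
  then have f: "root_elt X (e1 + e2) t ** root_elt X (2 *\<^sub>R e2) t = ?f (b * t)"
    "?f t = root_elt X (e1 + e2) (b * t) ** root_elt X (2 *\<^sub>R e2) (b * t)" for t
    by (simp_all add: e1_def e2_def a(2) b(2) mult.assoc)
  have "{root_elt X (e1 + e2) t ** root_elt X (2 *\<^sub>R e2) t | t. True} = {?f t | t. True}"
    using f by (intro equalityI subsetI; elim CollectE exE conjE) blast+
  moreover have "a * b * (a * b) = 1"
    using a(1) b(1) by (metis mult.assoc mult.commute mult_1)
  ultimately show ?thesis
    using diophantine_std[of G "a * b"] assms(3) large_subgroup_std[OF assms(1), of G] by simp
qed

end
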